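(* Suppose $W\in\mathcal{DT}$, i.e. $W$ is an operator of diagonal type on $L^2(\mathbb T)$. Then $\|W\|\le\|W\|_{\mathcal{DT}}$, where $\|W\|$ is the operator norm.
   Context: $\mathbb T=\mathbb R/(2\pi\mathbb Z)$ with measure $\frac1{2\pi}dx$. An operator $W$ on $L^2(\mathbb T)$ is described by its matrix $(W_{j,k})_{j,k\in\mathbb Z}$ in the basis $e^{ikx}$: if $f=\sum_kf_ke^{ikx}$ then $Wf=\sum_{j}\big(\sum_kW_{j,k}f_k\big)e^{ijx}$. Put $c_k=\sup_{j\in\mathbb Z}|W_{k+j,j}|$. $W$ is of diagonal type, $W\in\mathcal{DT}$, if $\sum_{k\in\mathbb Z}c_k<\infty$, and then $\|W\|_{\mathcal{DT}}=\sum_{k\in\mathbb Z}c_k$. *)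

theory Defs
  imports "HOL-Analysis.Analysis"
begin

text \<open>
  The circle \<open>\<real>/2\<pi>\<int>\<close> is represented by its fundamental domain \<open>[0, 2\<pi>)\<close>; the measure below
  lives on \<open>\<real>\<close>, is concentrated on \<open>[0, 2\<pi>)\<close>, and equals \<open>dx / 2\<pi>\<close> there.
\<close>

definition circle :: "real measure" where
  "circle = uniform_measure lborel {0..<2 * pi}"

definition square_integrable :: "(real \<Rightarrow> complex) \<Rightarrow> bool" where
  "square_integrable f \<longleftrightarrow>
     f \<in> borel_measurable circle \<and> integrable circle (\<lambda>x. (cmod (f x))\<^sup>2)"

lemma sets_circle [measurable_cong]: "sets circle = sets borel"
  by (simp add: circle_def)

lemma space_circle [simp]: "space circle = UNIV"
  by (simp add: circle_def)

lemma finite_measure_circle: "finite_measure circle"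
proof
  have "emeasure circle (space circle) = 1"
    unfolding circle_def by (subst emeasure_uniform_measure) (auto simp: ennreal_divide_self)
  then show "emeasure circle (space circle) \<noteq> \<infinity>" by simp
qed

lemma square_integrable_mult:
  assumes "square_integrable f" "square_integrable g"
  shows "integrable circle (\<lambda>x. f x * g x)"
proof (rule Bochner_Integration.integrable_bound)
  show "integrable circle (\<lambda>x. (cmod (f x))\<^sup>2 + (cmod (g x))\<^sup>2)"
    using assms by (auto simp: square_integrable_def)
  have [measurable]: "f \<in> borel_measurable circle" "g \<in> borel_measurable circle"
    using assms by (simp_all add: square_integrable_def)
  show "(\<lambda>x. f x * g x) \<in> borel_measurable circle"
    by measurable
  have "a * b \<le> a\<^sup>2 + b\<^sup>2" if "a \<ge> 0" "b \<ge> 0" for a b :: real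
    using sum_squares_bound[of a b] mult_nonneg_nonneg[OF that] by linarith
  then show "AE x in circle. norm (f x * g x) \<le> norm ((cmod (f x))\<^sup>2 + (cmod (g x))\<^sup>2)"
    by (auto simp: norm_mult)
qed

lemma square_integrable_zero: "square_integrable (\<lambda>_. 0)"
  by (simp add: square_integrable_def)

lemma square_integrable_add:
  assumes "square_integrable f" "square_integrable g"
  shows "square_integrable (\<lambda>x. f x + g x)"
  unfolding square_integrable_def
proof (intro conjI)
  have [measurable]: "f \<in> borel_measurable circle" "g \<in> borel_measurable circle"
    using assms by (simp_all add: square_integrable_def)
  show m: "(\<lambda>x. f x + g x) \<in> borel_measurable circle"
    by measurable
  show "integrable circle (\<lambda>x. (cmod (f x + g x))\<^sup>2)"
  proof (rule Bochner_Integration.integrable_bound)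
    show "integrable circle (\<lambda>x. 2 * (cmod (f x))\<^sup>2 + 2 * (cmod (g x))\<^sup>2)"
      using assms by (auto simp: square_integrable_def)
    show "(\<lambda>x. (cmod (f x + g x))\<^sup>2) \<in> borel_measurable circle"
      using m by measurable
    have "(cmod (a + b))\<^sup>2 \<le> 2 * (cmod a)\<^sup>2 + 2 * (cmod b)\<^sup>2" for a b
    proof -
      have "(cmod (a + b))\<^sup>2 \<le> (cmod a + cmod b)\<^sup>2"
        by (simp add: norm_triangle_ineq power_mono)
      also have "\<dots> \<le> 2 * (cmod a)\<^sup>2 + 2 * (cmod b)\<^sup>2"
        using sum_squares_bound[of "cmod a" "cmod b"] by (simp add: power2_sum)
      finally show ?thesis .
    qed
    then show "AE x in circle. norm ((cmod (f x + g x))\<^sup>2)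
        \<le> norm (2 * (cmod (f x))\<^sup>2 + 2 * (cmod (g x))\<^sup>2)"
      by auto
  qed
qed

lemma square_integrable_cmult:
  assumes "square_integrable f"
  shows "square_integrable (\<lambda>x. c * f x)"
  using assms by (auto simp: square_integrable_def norm_mult power_mult_distrib)

lemma square_integrable_cnj:
  assumes "square_integrable f"
  shows "square_integrable (\<lambda>x. cnj (f x))"
proof -
  have "cnj \<in> borel_measurable borel"
    by (intro borel_measurable_continuous_onI continuous_intros)
  then have "(\<lambda>x. cnj (f x)) \<in> borel_measurable circle"
    using assms unfolding square_integrable_def by (blast intro: measurable_compose)
  then show ?thesis
    using assms by (simp add: square_integrable_def)
qed

lemma square_integrable_cis: "square_integrable (\<lambda>x. cis (of_int k * x))"
proof -
  interpret finite_measure circle by (rule finite_measure_circle)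
  have "continuous_on UNIV (\<lambda>x. cis (of_int k * x))"
    by (intro continuous_intros)
  then have "(\<lambda>x. cis (of_int k * x)) \<in> borel_measurable circle"
    by (metis borel_measurable_continuous_onI measurable_cong_sets sets_circle)
  then show ?thesis
    by (simp add: square_integrable_def)
qed

text \<open>\<open>L\<^sup>2(\<real>/2\<pi>\<int>)\<close>: square integrable functions modulo equality almost everywhere.\<close>

quotient_type L2T = "real \<Rightarrow> complex" / partial:
  "\<lambda>f g. square_integrable f \<and> square_integrable g \<and> (AE x in circle. f x = g x)"
proof (rule part_equivpI)
  show "\<exists>f. square_integrable f \<and> square_integrable f \<and> (AE x in circle. f x = f x)"
    using square_integrable_zero by blast
qed (auto simp: symp_def transp_def elim: eventually_elim2)

instantiation L2T :: real_vector
begin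

lift_definition zero_L2T :: L2T is "\<lambda>_. 0"
  by (simp add: square_integrable_zero)

lift_definition plus_L2T :: "L2T \<Rightarrow> L2T \<Rightarrow> L2T" is "\<lambda>f g x. f x + g x"
  by (auto simp: square_integrable_add elim: eventually_elim2)

lift_definition uminus_L2T :: "L2T \<Rightarrow> L2T" is "\<lambda>f x. - f x"
  by (auto simp: square_integrable_def)

definition minus_L2T :: "L2T \<Rightarrow> L2T \<Rightarrow> L2T" where
  "minus_L2T f g = f + - g"

lift_definition scaleR_L2T :: "real \<Rightarrow> L2T \<Rightarrow> L2T" is "\<lambda>r f x. complex_of_real r * f x"
  by (auto simp: square_integrable_cmult)

instance
proof
  fix f g h :: L2T and r s :: real
  show "f + g + h = f + (g + h)"
    by transfer (simp add: square_integrable_add add.assoc)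
  show "f + g = g + f"
    by transfer (simp add: square_integrable_add add.commute)
  show "0 + f = f"
    by transfer simp
  show "- f + f = 0"
    by transfer (auto simp: square_integrable_zero)
  show "f - g = f + - g"
    by (rule minus_L2T_def)
  show "r *\<^sub>R (f + g) = r *\<^sub>R f + r *\<^sub>R g"
    by transfer (simp add: square_integrable_add square_integrable_cmult
        distrib_left del: distrib_left_numeral)
  show "(r + s) *\<^sub>R f = r *\<^sub>R f + s *\<^sub>R f"
    by transfer
      (use square_integrable_cmult[of _ "of_real r + of_real s"] in
        \<open>simp add: square_integrable_add square_integrable_cmult distrib_right\<close>)
  show "r *\<^sub>R s *\<^sub>R f = (r * s) *\<^sub>R f"
    by transfer
      (use square_integrable_cmult[of _ "of_real r * of_real s"] in
        \<open>simp add: square_integrable_cmult mult.assoc\<close>)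
  show "1 *\<^sub>R f = f"
    by transfer simp
qed

end

instantiation L2T :: real_inner
begin

lift_definition inner_L2T :: "L2T \<Rightarrow> L2T \<Rightarrow> real" is
  "\<lambda>f g. Re (LINT x|circle. f x * cnj (g x))"
proof -
  fix f f' g g' :: "real \<Rightarrow> complex"
  assume f: "square_integrable f \<and> square_integrable f' \<and> (AE x in circle. f x = f' x)"
    and g: "square_integrable g \<and> square_integrable g' \<and> (AE x in circle. g x = g' x)"
  have "AE x in circle. f x * cnj (g x) = f' x * cnj (g' x)"
    using f g by (auto elim: eventually_elim2)
  then have "(LINT x|circle. f x * cnj (g x)) = (LINT x|circle. f' x * cnj (g' x))"
    using f g by (intro integral_cong_AE borel_measurable_integrable
        square_integrable_mult square_integrable_cnj) auto
  then show "Re (LINT x|circle. f x * cnj (g x)) = Re (LINT x|circle. f' x * cnj (g' x))"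
    by simp
qed

lift_definition norm_L2T :: "L2T \<Rightarrow> real" is "\<lambda>f. sqrt (LINT x|circle. (cmod (f x))\<^sup>2)"
proof -
  fix f f' :: "real \<Rightarrow> complex"
  assume f: "square_integrable f \<and> square_integrable f' \<and> (AE x in circle. f x = f' x)"
  then have "AE x in circle. (cmod (f x))\<^sup>2 = (cmod (f' x))\<^sup>2"
    by (auto elim: eventually_mono)
  with f have "(LINT x|circle. (cmod (f x))\<^sup>2) = (LINT x|circle. (cmod (f' x))\<^sup>2)"
    by (intro integral_cong_AE borel_measurable_integrable) (auto simp: square_integrable_def)
  then show "sqrt (LINT x|circle. (cmod (f x))\<^sup>2) = sqrt (LINT x|circle. (cmod (f' x))\<^sup>2)"
    by simp
qed

definition dist_L2T :: "L2T \<Rightarrow> L2T \<Rightarrow> real" where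
  "dist_L2T f g = norm (f - g)"

definition sgn_L2T :: "L2T \<Rightarrow> L2T" where
  "sgn_L2T f = f /\<^sub>R norm f"

definition uniformity_L2T :: "(L2T \<times> L2T) filter" where
  "uniformity_L2T = (INF e\<in>{0<..}. principal {(f, g). dist f g < e})"

definition open_L2T :: "L2T set \<Rightarrow> bool" where
  "open_L2T U \<longleftrightarrow> (\<forall>f\<in>U. \<forall>\<^sub>F (f', g) in uniformity. f' = f \<longrightarrow> g \<in> U)"

instance
proof
  fix f g h :: L2T and r :: real and U :: "L2T set"
  show "dist f g = norm (f - g)"
    by (rule dist_L2T_def)
  show "sgn f = f /\<^sub>R norm f"
    by (rule sgn_L2T_def)
  show "uniformity = (INF e\<in>{0<..}. principal {(f :: L2T, g). dist f g < e})"
    by (rule uniformity_L2T_def)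
  show "open U \<longleftrightarrow> (\<forall>f\<in>U. \<forall>\<^sub>F (f', g) in uniformity. f' = f \<longrightarrow> g \<in> U)"
    by (rule open_L2T_def)
  show "f \<bullet> g = g \<bullet> f"
  proof transfer
    fix f g :: "real \<Rightarrow> complex"
    have "(LINT x|circle. f x * cnj (g x)) = (LINT x|circle. cnj (g x * cnj (f x)))"
      by (simp add: mult.commute)
    then have "(LINT x|circle. f x * cnj (g x)) = cnj (LINT x|circle. g x * cnj (f x))"
      by (simp only: Bochner_Integration.integral_cnj)
    then show "Re (LINT x|circle. f x * cnj (g x)) = Re (LINT x|circle. g x * cnj (f x))"
      by simp
  qed
  show "(f + g) \<bullet> h = f \<bullet> h + g \<bullet> h"
    by transfer (simp add: distrib_right square_integrable_mult square_integrable_cnj)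
  show "r *\<^sub>R f \<bullet> g = r * (f \<bullet> g)"
    by transfer (simp add: mult.assoc)
  have sq: "Re (LINT x|circle. f x * cnj (f x)) = (LINT x|circle. (cmod (f x))\<^sup>2)"
    for f :: "real \<Rightarrow> complex"
  proof -
    have "(LINT x|circle. f x * cnj (f x)) = (LINT x|circle. complex_of_real ((cmod (f x))\<^sup>2))"
      by (simp add: complex_norm_square del: of_real_power)
    then show ?thesis
      by (simp only: integral_complex_of_real Re_complex_of_real)
  qed
  show "0 \<le> f \<bullet> f"
    by transfer (simp add: sq)
  show "f \<bullet> f = 0 \<longleftrightarrow> f = 0"
  proof transfer
    fix f :: "real \<Rightarrow> complex"
    assume "square_integrable f \<and> square_integrable f \<and> (AE x in circle. f x = f x)"
    then have "integrable circle (\<lambda>x. (cmod (f x))\<^sup>2)" "square_integrable f"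
      by (auto simp: square_integrable_def)
    then show "Re (LINT x|circle. f x * cnj (f x)) = 0 \<longleftrightarrow>
        square_integrable f \<and> square_integrable (\<lambda>_. 0) \<and> (AE x in circle. f x = 0)"
      by (simp add: sq integral_nonneg_eq_0_iff_AE square_integrable_zero)
  qed
  show "norm f = sqrt (f \<bullet> f)"
    by transfer (simp add: sq)
qed

end

text \<open>The basis element \<open>e\<^sup>i\<^sup>k\<^sup>x\<close>.\<close>

lift_definition basis_exp :: "int \<Rightarrow> L2T" is "\<lambda>k x. cis (of_int k * x)"
  by (simp add: square_integrable_cis)

text \<open>The coefficient \<open>f\<^sub>k\<close> in the expansion \<open>f = \<Sum>\<^sub>k f\<^sub>k e\<^sup>i\<^sup>k\<^sup>x\<close>.\<close>

lift_definition fourier_coeff :: "L2T \<Rightarrow> int \<Rightarrow> complex" is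
  "\<lambda>f k. LINT x|circle. f x * cnj (cis (of_int k * x))"
proof -
  fix f f' :: "real \<Rightarrow> complex"
  assume f: "square_integrable f \<and> square_integrable f' \<and> (AE x in circle. f x = f' x)"
  have "(LINT x|circle. f x * cnj (cis (of_int k * x))) =
      (LINT x|circle. f' x * cnj (cis (of_int k * x)))" for k :: int
  proof (intro integral_cong_AE borel_measurable_integrable
      square_integrable_mult square_integrable_cnj square_integrable_cis)
    show "AE x in circle. f x * cnj (cis (of_int k * x)) = f' x * cnj (cis (of_int k * x))"
      using f by (auto elim: eventually_mono)
  qed (use f in auto)
  then show "(\<lambda>k :: int. LINT x|circle. f x * cnj (cis (of_int k * x))) =
      (\<lambda>k. LINT x|circle. f' x * cnj (cis (of_int k * x)))"
    by blast
qed

definition matrix_of :: "(L2T \<Rightarrow> L2T) \<Rightarrow> int \<Rightarrow> int \<Rightarrow> complex" where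
  "matrix_of W j k = fourier_coeff (W (basis_exp k)) j"

text \<open>
  \<open>W f = \<Sum>\<^sub>j (\<Sum>\<^sub>k W\<^sub>j\<^sub>k f\<^sub>k) e\<^sup>i\<^sup>j\<^sup>x\<close>, read coefficientwise. Neither linearity nor boundedness of
  \<open>W\<close> is presupposed.
\<close>

definition described_by_matrix :: "(L2T \<Rightarrow> L2T) \<Rightarrow> bool" where
  "described_by_matrix W \<longleftrightarrow>
     (\<forall>f j. ((\<lambda>k. matrix_of W j k * fourier_coeff f k) has_sum fourier_coeff (W f) j) UNIV)"

definition diagonal_sup :: "(L2T \<Rightarrow> L2T) \<Rightarrow> int \<Rightarrow> real" where
  "diagonal_sup W k = (SUP j. cmod (matrix_of W (k + j) j))"

text \<open>
  Since the supremum of an unbounded set of reals is unspecified, its finiteness is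
  required separately.
\<close>

definition diagonal_type :: "(L2T \<Rightarrow> L2T) \<Rightarrow> bool" where
  "diagonal_type W \<longleftrightarrow>
     described_by_matrix W \<and>
     (\<forall>k. bdd_above (range (\<lambda>j. cmod (matrix_of W (k + j) j)))) \<and>
     diagonal_sup W summable_on UNIV"

definition DT_norm :: "(L2T \<Rightarrow> L2T) \<Rightarrow> real" where
  "DT_norm W = (\<Sum>\<^sub>\<infinity>k. diagonal_sup W k)"

end

(*
  Parseval's identity reduces the claim to coefficients. There it is Schur's test: since
  |W_jk| is at most c_(j-k), Cauchy-Schwarz gives
    |(W f)_j|^2 <= ||W||_DT * sum_k c_(j-k) |f_k|^2,
  and summing over j bounds the right-hand side by ||W||_DT^2 * ||f||^2. Parseval also makes
  the coefficients of an element determine it, whence W is linear.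

  For Parseval, trigonometric polynomials must be dense in L^2: Stone-Weierstrass on the unit
  circle and dominated convergence give indicators of closed sets, a Dynkin argument gives
  Borel sets, and simple functions give the rest.
*)
theory Submission
  imports Defs
begin

section \<open>Parseval's identity in real inner product spaces\<close>

text \<open>Expand the square and complete it: orthonormality reduces the inner product of the
  combination with \<open>c\<close> to \<open>a c\<close>. The identity serves twice below, with an
  arbitrary approximant for the lower bound and with \<open>a b\<close> equal to
  \<open>f \<bullet> b\<close> for Bessel's inequality.\<close>

lemma sum_norm_diff_orthonormal:
  fixes f :: "'a::real_inner"
  assumes "finite F" and norm: "\<And>b. b \<in> F \<Longrightarrow> norm b = 1" and orth: "pairwise orthogonal F"
  shows "(norm (f - (\<Sum>b\<in>F. a b *\<^sub>R b)))\<^sup>2 + (\<Sum>b\<in>F. (f \<bullet> b)\<^sup>2) =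
    (norm f)\<^sup>2 + (\<Sum>b\<in>F. (f \<bullet> b - a b)\<^sup>2)"
proof -
  let ?p = "\<Sum>b\<in>F. a b *\<^sub>R b"
  have "?p \<bullet> c = a c" if "c \<in> F" for c
  proof -
    have "?p \<bullet> c = (\<Sum>b\<in>F. if b = c then a c else 0)"
      unfolding inner_sum_left
    proof (rule sum.cong)
      fix b assume "b \<in> F"
      then show "a b *\<^sub>R b \<bullet> c = (if b = c then a c else 0)"
        using norm[OF that] orth that
        by (auto simp: pairwise_def orthogonal_def norm_eq_1)
    qed simp
    then show ?thesis using that \<open>finite F\<close> by simp
  qed
  then have "?p \<bullet> ?p = (\<Sum>b\<in>F. (a b)\<^sup>2)"
    by (simp add: inner_sum_right power2_eq_square)
  moreover have "f \<bullet> ?p = (\<Sum>b\<in>F. a b * (f \<bullet> b))"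
    by (simp add: inner_sum_right)
  ultimately show ?thesis
    by (simp add: power2_norm_eq_inner inner_diff_left inner_diff_right inner_commute[of ?p f]
        power2_diff sum.distrib sum_subtractf sum_negf sum_distrib_left mult_ac)
qed

text \<open>An approximant supported on a finite set \<open>F\<close> shows that \<open>F\<close>
  already carries the squared norm up to \<open>e\<close>. Every finite \<open>G\<close> containing
  \<open>F\<close> carries at least as much, and by Bessel never more than the whole.\<close>

lemma parseval_orthonormal:
  fixes B :: "'a::real_inner set"
  assumes norm: "\<And>b. b \<in> B \<Longrightarrow> norm b = 1" and orth: "pairwise orthogonal B"
    and dense: "closure (span B) = UNIV"
  shows "((\<lambda>b. (f \<bullet> b)\<^sup>2) has_sum (norm f)\<^sup>2) B"
  unfolding has_sum_def tendsto_iff eventually_finite_subsets_at_top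
proof (intro allI impI)
  fix e :: real assume "e > 0"
  then have "sqrt e > 0" by simp
  \<comment> \<open>The radius is \<open>sqrt e\<close> because the squared distance is what bounds
    the error of the sum.\<close>
  then obtain p where p: "p \<in> span B" "dist p f < sqrt e"
    using dense closure_approachable[of f "span B"] by blast
  then obtain F a where F: "finite F" "F \<subseteq> B" "p = (\<Sum>b\<in>F. a b *\<^sub>R b)"
    by (auto simp: span_explicit)
  have close: "(norm (f - p))\<^sup>2 < e"
    using power_strict_mono[of "norm (f - p)" "sqrt e" 2] p(2) \<open>e > 0\<close>
    by (simp add: dist_norm norm_minus_commute)
  have "dist (\<Sum>b\<in>G. (f \<bullet> b)\<^sup>2) ((norm f)\<^sup>2) < e" if G: "finite G" "F \<subseteq> G" "G \<subseteq> B" for G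
  proof -
    have expand: "(norm (f - (\<Sum>b\<in>H. c b *\<^sub>R b)))\<^sup>2 + (\<Sum>b\<in>H. (f \<bullet> b)\<^sup>2) =
        (norm f)\<^sup>2 + (\<Sum>b\<in>H. (f \<bullet> b - c b)\<^sup>2)" if "finite H" "H \<subseteq> B" for H c
      using that norm pairwise_subset[OF orth] by (intro sum_norm_diff_orthonormal) auto
    have "(norm f)\<^sup>2 \<le> (norm (f - p))\<^sup>2 + (\<Sum>b\<in>F. (f \<bullet> b)\<^sup>2)"
      using expand[OF F(1,2), of a] sum_nonneg[of F "\<lambda>b. (f \<bullet> b - a b)\<^sup>2"] by (simp add: F(3))
    also have "\<dots> < e + (\<Sum>b\<in>G. (f \<bullet> b)\<^sup>2)"
      using close G by (intro add_less_le_mono sum_mono2) auto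
    finally have "(norm f)\<^sup>2 < e + (\<Sum>b\<in>G. (f \<bullet> b)\<^sup>2)" .
    moreover have "(\<Sum>b\<in>G. (f \<bullet> b)\<^sup>2) \<le> (norm f)\<^sup>2"
    proof -
      \<comment> \<open>Taking the inner products themselves as coefficients makes the last sum of
        \<open>expand\<close> vanish.\<close>
      have "(norm (f - (\<Sum>b\<in>G. (f \<bullet> b) *\<^sub>R b)))\<^sup>2 + (\<Sum>b\<in>G. (f \<bullet> b)\<^sup>2) = (norm f)\<^sup>2"
        using expand[OF G(1,3), of "\<lambda>b. f \<bullet> b"] by simp
      then show ?thesis
        using zero_le_power2[of "norm (f - (\<Sum>b\<in>G. (f \<bullet> b) *\<^sub>R b))"] by linarith
    qed
    ultimately show ?thesis by (simp add: dist_real_def)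
  qed
  then show "\<exists>X. finite X \<and> X \<subseteq> B \<and>
      (\<forall>Y. finite Y \<and> X \<subseteq> Y \<and> Y \<subseteq> B \<longrightarrow> dist (\<Sum>b\<in>Y. (f \<bullet> b)\<^sup>2) ((norm f)\<^sup>2) < e)"
    using F by blast
qed

section \<open>Characters and Fourier coefficients\<close>

text \<open>\<open>L2T\<close> carries only real scalar multiplication, so the complex factor is
  built into the element.\<close>

lift_definition character :: "complex \<Rightarrow> int \<Rightarrow> L2T" is "\<lambda>c k x. c * cis (of_int k * x)"
  by (simp add: square_integrable_cis square_integrable_cmult)

lemma AE_circle: "AE x in circle. x \<in> {0..<2 * pi}"
  unfolding circle_def by (rule AE_uniform_measureI) auto

text \<open>For nonzero \<open>n\<close> the antiderivative e^(inx)/(in) takes the same value at 0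
  and at 2 pi; for \<open>n\<close> = 0 the integral is the total mass 1.\<close>

lemma integral_circle_cis:
  fixes n :: int
  shows "(LINT x|circle. cis (of_int n * x)) = (if n = 0 then 1 else 0)"
proof -
  interpret finite_measure circle by (rule finite_measure_circle)
  have "measure circle UNIV = 1"
    unfolding circle_def measure_def by (subst emeasure_uniform_measure) (auto simp: ennreal_divide_self)
  moreover have "(LINT x|circle. cis (of_int n * x)) = 0" if "n \<noteq> 0"
  proof -
    define F where "F x = cis (of_int n * x) / (\<i> * of_int n)" for x :: real
    have cont: "continuous_on A (\<lambda>x. cis (of_int n * x))" for A
      by (intro continuous_intros)
    have meas [measurable]: "(\<lambda>x. cis (of_int n * x)) \<in> borel_measurable borel"
      by (rule borel_measurable_continuous_onI[OF cont])
    have "(F has_vector_derivative cis (of_int n * x)) (at x within A)" for x A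
      unfolding F_def has_vector_derivative_complex_iff using that
      by (auto intro!: derivative_eq_intros simp: Re_divide Im_divide divide_simps power2_eq_square)
    then have "(LINT x|lborel. indicator {0..2*pi} x *\<^sub>R cis (of_int n * x)) = F (2 * pi) - F 0"
      by (intro integral_FTC_Icc cont) simp_all
    also have "\<dots> = 0"
    proof -
      have "cis (of_int n * (2 * pi)) = 1"
        by (auto simp: complex_eq_iff mult.commute[of _ "2 * pi"] cos_int_2pin sin_int_2pin)
      then show ?thesis by (simp add: F_def)
    qed
    finally have int: "(LINT x|lborel. indicator {0..2*pi} x *\<^sub>R cis (of_int n * x)) = 0" .
    \<comment> \<open>A real-valued weight is the form in which \<open>integral_density\<close>
      applies.\<close>
    have eq: "circle = density lborel (\<lambda>x. ennreal (indicator {0..<2 * pi} x / (2 * pi)))"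
      unfolding circle_def uniform_measure_def
      by (intro density_cong) (auto simp: indicator_def divide_ennreal ennreal_1[symmetric] simp del: ennreal_1)
    have "(LINT x|circle. cis (of_int n * x)) =
        (LINT x|lborel. (indicator {0..<2 * pi} x / (2 * pi)) *\<^sub>R cis (of_int n * x))"
      unfolding eq by (intro integral_density borel_measurable_continuous_onI cont) auto
    \<comment> \<open>The fundamental theorem of calculus was used on the closed interval; adding
      its right endpoint changes a null set only.\<close>
    also have "\<dots> = (LINT x|lborel. (1 / (2 * pi)) *\<^sub>R (indicator {0..2 * pi} x *\<^sub>R cis (of_int n * x)))"
    proof (rule integral_cong_AE)
      show "AE x in lborel. (indicator {0..<2 * pi} x / (2 * pi)) *\<^sub>R cis (of_int n * x) =
          (1 / (2 * pi)) *\<^sub>R (indicator {0..2 * pi} x *\<^sub>R cis (of_int n * x))"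
        using AE_lborel_singleton[of "2 * pi"] by eventually_elim (auto simp: indicator_def)
    qed simp_all
    also have "\<dots> = 0"
      by (simp only: integral_scaleR_right int scaleR_zero_right)
    finally show ?thesis .
  qed
  ultimately show ?thesis by simp
qed

lemma fourier_coeff_character: "fourier_coeff (character c k) j = (if j = k then c else 0)"
proof transfer
  fix c :: complex and k j :: int
  have "(LINT x|circle. c * cis (of_int k * x) * cnj (cis (of_int j * x))) =
      (LINT x|circle. c * cis (of_int (k - j) * x))"
    by (simp add: cis_cnj cis_mult mult.assoc left_diff_distrib)
  then show "(LINT x|circle. c * cis (of_int k * x) * cnj (cis (of_int j * x))) =
      (if j = k then c else 0)"
    using integral_circle_cis[of "k - j"] by auto
qed

text \<open>This links the real inner product to the complex coefficients: \<open>c\<close> = 1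
  extracts the real part of the coefficient and \<open>c\<close> = \<open>\<i>\<close> the imaginary
  part.\<close>

lemma inner_character: "f \<bullet> character c k = Re (cnj c * fourier_coeff f k)"
proof transfer
  fix f :: "real \<Rightarrow> complex" and c :: complex and k :: int
  have "(LINT x|circle. f x * cnj (c * cis (of_int k * x))) =
      (LINT x|circle. cnj c * (f x * cnj (cis (of_int k * x))))"
    by (simp add: mult_ac)
  also have "\<dots> = cnj c * (LINT x|circle. f x * cnj (cis (of_int k * x)))"
    by simp
  finally show "Re (LINT x|circle. f x * cnj (c * cis (of_int k * x))) =
      Re (cnj c * (LINT x|circle. f x * cnj (cis (of_int k * x))))"
    by simp
qed

text \<open>Both families are needed, since over the reals the multiples of e^(ikx) by 1 and by
  \<open>\<i>\<close> are independent.\<close>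

abbreviation characters :: "L2T set" where
  "characters \<equiv> range (character 1) \<union> range (character \<i>)"

lemma fourier_coeff_add: "fourier_coeff (f + g) k = fourier_coeff f k + fourier_coeff g k"
  by transfer (simp add: distrib_right square_integrable_mult square_integrable_cnj square_integrable_cis)

lemma fourier_coeff_scaleR: "fourier_coeff (r *\<^sub>R f) k = of_real r * fourier_coeff f k"
  by transfer (simp add: mult.assoc)

section \<open>The closed span of the characters\<close>

lemma subspace_closure:
  fixes S :: "'a::real_normed_vector set"
  assumes "subspace S"
  shows "subspace (closure S)"
  unfolding subspace_def
proof (intro conjI ballI allI)
  show "0 \<in> closure S" using assms subspace_0 closure_subset by blast
next
  fix x y assume "x \<in> closure S" "y \<in> closure S"
  then obtain f g where "\<And>n. f n \<in> S" "f \<longlonglongrightarrow> x" "\<And>n. g n \<in> S" "g \<longlonglongrightarrow> y"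
    unfolding closure_sequential by metis
  then show "x + y \<in> closure S"
    unfolding closure_sequential using assms
    by (intro exI[of _ "\<lambda>n. f n + g n"]) (auto intro: subspace_add tendsto_add)
next
  fix c :: real and x assume "x \<in> closure S"
  then obtain f where "\<And>n. f n \<in> S" "f \<longlonglongrightarrow> x"
    unfolding closure_sequential by metis
  then show "c *\<^sub>R x \<in> closure S"
    unfolding closure_sequential using assms
    by (intro exI[of _ "\<lambda>n. c *\<^sub>R f n"]) (auto intro: subspace_mul tendsto_scaleR)
qed

text \<open>Dominated convergence: the limit inherits the majorant \<open>w\<close>, so the squared
  differences are bounded by the integrable function 4 w^2.\<close>

lemma abs_L2T_tendsto:
  assumes [measurable]: "\<And>n. u n \<in> borel_measurable circle" "f \<in> borel_measurable circle"
    and w: "integrable circle (\<lambda>x. (w x)\<^sup>2)"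
    and bound: "\<And>n x. cmod (u n x) \<le> w x"
    and lim: "\<And>x. (\<lambda>n. u n x) \<longlonglongrightarrow> f x"
  shows "\<And>n. square_integrable (u n)" "square_integrable f"
    "(\<lambda>n. abs_L2T (u n)) \<longlonglongrightarrow> abs_L2T f"
proof -
  have sq: "square_integrable g"
    if [measurable]: "g \<in> borel_measurable circle" and g: "\<And>x. cmod (g x) \<le> w x" for g
    unfolding square_integrable_def
  proof
    show "integrable circle (\<lambda>x. (cmod (g x))\<^sup>2)"
      by (rule Bochner_Integration.integrable_bound[OF w]) (auto intro!: power_mono g)
  qed simp
  have f_le: "cmod (f x) \<le> w x" for x
    by (rule tendsto_upperbound[OF tendsto_norm[OF lim]]) (auto simp: bound)
  show u: "square_integrable (u n)" for n by (rule sq) (auto simp: bound)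
  show f: "square_integrable f" by (rule sq) (auto simp: f_le)
  have "(\<lambda>n. LINT x|circle. (cmod (u n x - f x))\<^sup>2) \<longlonglongrightarrow> (LINT x|circle. 0)"
  proof (rule integral_dominated_convergence)
    show "integrable circle (\<lambda>x. 4 * (w x)\<^sup>2)" using w by simp
    show "AE x in circle. (\<lambda>n. (cmod (u n x - f x))\<^sup>2) \<longlonglongrightarrow> 0"
    proof (rule AE_I2)
      fix x
      have "(\<lambda>n. (cmod (u n x - f x))\<^sup>2) \<longlonglongrightarrow> (cmod (f x - f x))\<^sup>2"
        by (intro tendsto_intros lim)
      then show "(\<lambda>n. (cmod (u n x - f x))\<^sup>2) \<longlonglongrightarrow> 0" by simp
    qed
    show "AE x in circle. norm ((cmod (u n x - f x))\<^sup>2) \<le> 4 * (w x)\<^sup>2" for n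
    proof (rule AE_I2)
      fix x
      have "cmod (u n x - f x) \<le> 2 * w x"
        using norm_triangle_ineq4[of "u n x" "f x"] bound[of n x] f_le[of x] by linarith
      then have "(cmod (u n x - f x))\<^sup>2 \<le> (2 * w x)\<^sup>2" by (intro power_mono) auto
      then show "norm ((cmod (u n x - f x))\<^sup>2) \<le> 4 * (w x)\<^sup>2" by (simp add: power_mult_distrib)
    qed
  qed simp_all
  moreover have "norm (abs_L2T (u n) - abs_L2T f) = sqrt (LINT x|circle. (cmod (u n x - f x))\<^sup>2)" for n
  proof -
    have m: "square_integrable (\<lambda>x. - f x)" using f by (simp add: square_integrable_def)
    have "abs_L2T (u n) - abs_L2T f = abs_L2T (\<lambda>x. u n x + - f x)"
      using u[of n] f m by (simp add: minus_L2T_def uminus_L2T.abs_eq plus_L2T.abs_eq)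
    then show ?thesis
      using square_integrable_add[OF u[of n] m] by (simp add: norm_L2T.abs_eq)
  qed
  ultimately have "(\<lambda>n. norm (abs_L2T (u n) - abs_L2T f)) \<longlonglongrightarrow> sqrt 0"
    by (simp only:) (intro tendsto_real_sqrt, simp)
  then show "(\<lambda>n. abs_L2T (u n)) \<longlonglongrightarrow> abs_L2T f"
    by (simp add: LIM_zero_iff tendsto_norm_zero_iff)
qed

text \<open>A predicate on representing functions rather than on classes, so that pointwise limits
  and indicators can be handled directly.\<close>

definition spanned :: "(real \<Rightarrow> complex) \<Rightarrow> bool" where
  "spanned f \<longleftrightarrow> square_integrable f \<and> abs_L2T f \<in> closure (span characters)"

lemma spanned_add:
  assumes "spanned f" "spanned g"
  shows "spanned (\<lambda>x. f x + g x)"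
  using assms square_integrable_add[of f g]
    subspace_add[OF subspace_closure[OF subspace_span], of "abs_L2T f" characters "abs_L2T g"]
  by (auto simp: spanned_def plus_L2T.abs_eq)

text \<open>The span is real, so the complex coefficient is split into its real and imaginary parts,
  one for each family of characters.\<close>

lemma spanned_character: "spanned (\<lambda>x. c * cis (of_int k * x))"
proof -
  have sq: "square_integrable (\<lambda>x. c * cis (of_int k * x))" for c
    by (simp add: square_integrable_cis square_integrable_cmult)
  have "abs_L2T (\<lambda>x. c * cis (of_int k * x)) = Re c *\<^sub>R character 1 k + Im c *\<^sub>R character \<i> k"
    unfolding character.abs_eq
    by (subst scaleR_L2T.abs_eq plus_L2T.abs_eq;
        (simp add: sq square_integrable_cmult square_integrable_cis)?)+
      (simp add: mult.assoc[symmetric] distrib_right[symmetric] complex_eq[symmetric] mult.commute[of _ \<i>])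
  also have "\<dots> \<in> span characters"
    by (intro span_add span_mul span_base) auto
  finally show ?thesis
    using sq closure_subset unfolding spanned_def by blast
qed

lemma spanned_zero: "spanned (\<lambda>x. 0)"
  using spanned_character[of 0 0] by simp

lemma spanned_sum:
  assumes "\<And>i. i \<in> I \<Longrightarrow> spanned (f i)"
  shows "spanned (\<lambda>x. \<Sum>i\<in>I. f i x)"
  using assms by (induction I rule: infinite_finite_induct) (auto simp: spanned_zero spanned_add)

text \<open>Every limit passage below goes through this: from trigonometric polynomials to
  continuous functions, from those to closed sets, from finite to countable disjoint unions, and
  from simple to square integrable functions.\<close>

lemma spanned_limit:
  assumes u: "\<And>n. spanned (u n)" and f: "f \<in> borel_measurable circle"
    and w: "integrable circle (\<lambda>x. (w x)\<^sup>2)"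
    and bound: "\<And>n x. cmod (u n x) \<le> w x"
    and lim: "\<And>x. (\<lambda>n. u n x) \<longlonglongrightarrow> f x"
  shows "spanned f"
proof -
  have m: "u n \<in> borel_measurable circle" for n
    using u by (auto simp: spanned_def square_integrable_def)
  show ?thesis
    unfolding spanned_def
    using abs_L2T_tendsto(2)[OF m f w bound lim] abs_L2T_tendsto(3)[OF m f w bound lim] u
      closed_sequentially[OF closed_closure, of "\<lambda>n. abs_L2T (u n)" "span characters"]
    by (auto simp: spanned_def)
qed

text \<open>Functions of \<open>cis x\<close> are periodic on the whole line, so they can be
  expected to agree with a given function only on the fundamental domain, that is, almost
  everywhere.\<close>

lemma spanned_AE:
  assumes "spanned f" "g \<in> borel_measurable circle" "AE x in circle. f x = g x"
  shows "spanned g"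
proof -
  have f: "f \<in> borel_measurable circle" "integrable circle (\<lambda>x. (cmod (f x))\<^sup>2)" "square_integrable f"
    using assms by (auto simp: spanned_def square_integrable_def)
  have "integrable circle (\<lambda>x. (cmod (g x))\<^sup>2)"
    by (rule integrable_cong_AE_imp[OF f(2)]) (use assms in \<open>auto elim: eventually_mono\<close>)
  then have g: "square_integrable g" using assms by (simp add: square_integrable_def)
  then have "abs_L2T f = abs_L2T g"
    using f assms by (intro Quotient3_rel_abs[OF Quotient3_L2T]) simp
  then show ?thesis using g assms by (simp add: spanned_def)
qed

section \<open>Uniform approximation by trigonometric polynomials\<close>

text \<open>Generated by sums alone, so that induction yields \<open>spanned\<close> at once;
  closure under products is derived from the addition of exponents.\<close>

inductive trig_poly :: "(real \<Rightarrow> complex) \<Rightarrow> bool" where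
  monomial: "trig_poly (\<lambda>x. c * cis (of_int k * x))"
| add: "trig_poly f \<Longrightarrow> trig_poly g \<Longrightarrow> trig_poly (\<lambda>x. f x + g x)"

lemma trig_poly_monomial_mult:
  assumes "trig_poly g"
  shows "trig_poly (\<lambda>x. c * cis (of_int k * x) * g x)"
  using assms
proof induction
  case (monomial d l)
  have "(\<lambda>x. c * cis (of_int k * x) * (d * cis (of_int l * x))) =
      (\<lambda>x. (c * d) * cis (of_int (k + l) * x))"
    by (auto simp: fun_eq_iff cis_mult[symmetric] distrib_right)
  then show ?case using trig_poly.monomial by metis
next
  case (add f g)
  then show ?case using trig_poly.add by (simp add: distrib_left)
qed

lemma trig_poly_mult:
  assumes "trig_poly f" "trig_poly g"
  shows "trig_poly (\<lambda>x. f x * g x)"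
  using assms
proof induction
  case (monomial c k)
  then show ?case by (rule trig_poly_monomial_mult)
next
  case (add f h)
  then show ?case using trig_poly.add by (simp add: distrib_right)
qed

lemma trig_poly_const: "trig_poly (\<lambda>x. c)"
  using trig_poly.monomial[of c 0] by simp

lemma trig_poly_cos: "trig_poly (\<lambda>x. of_real (cos x))"
proof -
  have "(\<lambda>x. complex_of_real (cos x)) =
      (\<lambda>x. (1 / 2) * cis (of_int 1 * x) + (1 / 2) * cis (of_int (- 1) * x))"
    by (auto simp: fun_eq_iff complex_eq_iff)
  then show ?thesis using trig_poly.add trig_poly.monomial by metis
qed

lemma trig_poly_sin: "trig_poly (\<lambda>x. of_real (sin x))"
proof -
  have "(\<lambda>x. complex_of_real (sin x)) =
      (\<lambda>x. (- \<i> / 2) * cis (of_int 1 * x) + (\<i> / 2) * cis (of_int (- 1) * x))"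
    by (auto simp: fun_eq_iff complex_eq_iff)
  then show ?thesis using trig_poly.add trig_poly.monomial by metis
qed

lemma spanned_trig_poly: "trig_poly f \<Longrightarrow> spanned f"
  by (induction rule: trig_poly.induct) (auto simp: spanned_character spanned_add)

text \<open>Real Stone-Weierstrass on the compact unit circle, for the algebra of continuous real
  functions on the plane that become trigonometric polynomials when composed with
  \<open>cis\<close>.\<close>

lemma trig_poly_approx:
  fixes g :: "complex \<Rightarrow> real"
  assumes "continuous_on UNIV g" "e > 0"
  obtains p where "trig_poly p" "\<And>x. cmod (of_real (g (cis x)) - p x) < e"
proof -
  have "\<exists>f. (continuous_on UNIV f \<and> trig_poly (\<lambda>x. of_real (f (cis x)))) \<and>
      (\<forall>z\<in>sphere 0 1. \<bar>g z - f z\<bar> < e)"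
  proof (rule Stone_Weierstrass_HOL)
    \<comment> \<open>The coordinates \<open>Re\<close> and \<open>Im\<close> separate points;
      composed with \<open>cis\<close> they are cosine and sine.\<close>
    fix z w :: complex assume "z \<in> sphere 0 1 \<and> w \<in> sphere 0 1 \<and> z \<noteq> w"
    then consider "Re z \<noteq> Re w" | "Im z \<noteq> Im w" by (auto simp: complex_eq_iff)
    then show "\<exists>f. (continuous_on UNIV f \<and> trig_poly (\<lambda>x. of_real (f (cis x)))) \<and> f z \<noteq> f w"
    proof cases
      case 1
      then show ?thesis
        by (intro exI[of _ Re]) (auto simp: trig_poly_cos intro: continuous_intros)
    next
      case 2
      then show ?thesis
        by (intro exI[of _ Im]) (auto simp: trig_poly_sin intro: continuous_intros)
    qed
  qed (use assms in \<open>auto simp: trig_poly_const trig_poly.add trig_poly_mult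
        intro: continuous_intros continuous_on_subset\<close>)
  then obtain f where f: "trig_poly (\<lambda>x. of_real (f (cis x)))" "\<forall>z\<in>sphere 0 1. \<bar>g z - f z\<bar> < e"
    by blast
  have "cmod (of_real (g (cis x)) - of_real (f (cis x))) < e" for x
    using f(2) by (simp flip: of_real_diff)
  with f(1) that show thesis by blast
qed

lemma cis_borel_measurable [measurable]: "cis \<in> borel_measurable borel"
  by (intro borel_measurable_continuous_onI continuous_intros)

lemma integrable_circle_const: "integrable circle (\<lambda>x. c :: real)"
proof -
  interpret finite_measure circle by (rule finite_measure_circle)
  show ?thesis by simp
qed

lemma spanned_continuous:
  fixes g :: "complex \<Rightarrow> real"
  assumes g: "continuous_on UNIV g" and bound: "\<And>z. \<bar>g z\<bar> \<le> C"
  shows "spanned (\<lambda>x. c * of_real (g (cis x)))"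
proof -
  have "\<exists>p. trig_poly p \<and> (\<forall>x. cmod (of_real (g (cis x)) - p x) < inverse (Suc n))" for n
    using trig_poly_approx[OF g, of "inverse (Suc n)"] by (metis inverse_positive_iff_positive of_nat_0_less_iff zero_less_Suc)
  then obtain p where p: "\<And>n. trig_poly (p n)"
    "\<And>n x. cmod (of_real (g (cis x)) - p n x) < inverse (Suc n)"
    by metis
  show ?thesis
  \<comment> \<open>All errors are at most 1, so every approximant of \<open>g\<close> is bounded by
    \<open>C + 1\<close>.\<close>
  proof (rule spanned_limit[where w = "\<lambda>_. cmod c * (C + 1)"])
    show "spanned (\<lambda>x. c * p n x)" for n
      by (intro spanned_trig_poly trig_poly_mult trig_poly_const p)
    have [measurable]: "g \<in> borel_measurable borel"
      using g by (rule borel_measurable_continuous_onI)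
    show "(\<lambda>x. c * of_real (g (cis x))) \<in> borel_measurable circle"
      by measurable
    show "cmod (c * p n x) \<le> cmod c * (C + 1)" for n x
    proof -
      have "cmod (p n x) \<le> cmod (of_real (g (cis x))) + cmod (of_real (g (cis x)) - p n x)"
        by (metis norm_minus_commute norm_triangle_sub)
      also have "\<dots> \<le> C + inverse (Suc n)"
        using bound[of "cis x"] p(2)[where n=n and x=x] by (intro add_mono) auto
      also have "\<dots> \<le> C + 1" by (simp add: inverse_le_1_iff)
      finally show ?thesis by (simp add: norm_mult mult_left_mono)
    qed
    show "(\<lambda>n. c * p n x) \<longlonglongrightarrow> c * of_real (g (cis x))" for x
    proof -
      have "(\<lambda>n. p n x - of_real (g (cis x))) \<longlonglongrightarrow> 0"
        by (rule Lim_null_comparison[OF _ LIMSEQ_inverse_real_of_nat])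
          (use p(2)[THEN less_imp_le] in \<open>auto simp: norm_minus_commute\<close>)
      then show ?thesis by (intro tendsto_mult_left) (simp add: LIM_zero_iff)
    qed
  qed (rule integrable_circle_const)
qed

section \<open>From closed sets to all square integrable functions\<close>

text \<open>The continuous cut-offs max(0, 1 - n dist(z, A)) are 1 on \<open>A\<close>, and off the
  closed set \<open>A\<close> they are eventually 0.\<close>

lemma spanned_indicator_closed:
  assumes "closed A"
  shows "spanned (\<lambda>x. c * indicator A (cis x))"
\<comment> \<open>By convention \<open>infdist\<close> to the empty set is 0, so the cut-offs would
  be constantly 1 there.\<close>
proof (cases "A = {}")
  case True
  then show ?thesis using spanned_zero by simp
next
  case False
  define g :: "nat \<Rightarrow> complex \<Rightarrow> real" where "g n z = max 0 (1 - n * infdist z A)" for n z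
  show ?thesis
  proof (rule spanned_limit[where u = "\<lambda>n x. c * of_real (g n (cis x))" and w = "\<lambda>_. cmod c"])
    have g_le: "0 \<le> g n z" "g n z \<le> 1" for n z
      by (auto simp: g_def infdist_nonneg)
    show "spanned (\<lambda>x. c * of_real (g n (cis x)))" for n
    proof (rule spanned_continuous)
      show "continuous_on UNIV (g n)"
        unfolding g_def by (intro continuous_intros)
      show "\<bar>g n z\<bar> \<le> 1" for z using g_le[of n z] by simp
    qed
    show "cmod (c * of_real (g n (cis x))) \<le> cmod c" for n x
      using g_le[of n "cis x"] by (simp add: norm_mult mult_left_le)
    have [measurable]: "A \<in> sets borel" using assms by (rule borel_closed)
    show "(\<lambda>x. c * indicator A (cis x)) \<in> borel_measurable circle"
      by measurable
    have "(\<lambda>n. g n z) \<longlonglongrightarrow> indicator A z" for z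
    proof (cases "z \<in> A")
      case True
      then show ?thesis by (simp add: g_def)
    next
      case False
      then have pos: "infdist z A > 0"
        using assms \<open>A \<noteq> {}\<close> infdist_pos_not_in_closed by blast
      then obtain N :: nat where N: "1 < N * infdist z A"
        using reals_Archimedean3 by blast
      have "g n z = 0" if "n \<ge> N" for n
      proof -
        have "N * infdist z A \<le> n * infdist z A"
          using that pos by (intro mult_right_mono) auto
        then show ?thesis using N by (simp add: g_def)
      qed
      then show ?thesis
        using False by (intro tendsto_eventually) (auto simp: eventually_sequentially)
    qed
    from tendsto_of_real[OF this]
    show "(\<lambda>n. c * of_real (g n (cis x))) \<longlonglongrightarrow> c * indicator A (cis x)" for x
      by (intro tendsto_mult_left) (simp add: of_real_indicator)
  qed (rule integrable_circle_const)
qed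

text \<open>Dynkin's argument: closed sets form an intersection-stable generator, a complement is a
  difference from a constant, and a disjoint union is a dominated limit of finite sums.\<close>

lemma spanned_indicator_borel:
  assumes "A \<in> sets borel"
  shows "spanned (\<lambda>x. c * indicator A (cis x))"
proof -
  have "Int_stable (Collect closed :: complex set set)" "Collect closed \<subseteq> Pow UNIV"
    by (auto simp: Int_stable_def)
  moreover have "A \<in> sigma_sets UNIV (Collect closed)"
    using assms by (simp add: borel_eq_closed)
  ultimately show ?thesis
  \<comment> \<open>The coefficient is generalized because the complement step uses the hypothesis
    for \<open>- c\<close>.\<close>
  proof (induction arbitrary: c rule: sigma_sets_induct_disjoint)
    case (basic A)
    then show ?case by (simp add: spanned_indicator_closed)
  next
    case empty
    then show ?case by (simp add: spanned_zero)
  next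
    case (compl A)
    have "spanned (\<lambda>x. c * cis (of_int 0 * x) + (- c) * indicator A (cis x))"
      by (intro spanned_add spanned_character compl.IH)
    also have "(\<lambda>x. c * cis (of_int 0 * x) + (- c) * indicator A (cis x)) =
        (\<lambda>x. c * indicator (UNIV - A) (cis x))"
      by (auto simp: fun_eq_iff indicator_def)
    finally show ?case .
  next
    case (union A)
    show ?case
    proof (rule spanned_limit[where u = "\<lambda>n x. \<Sum>i<n. c * indicator (A i) (cis x)" and w = "\<lambda>_. cmod c"])
      show "spanned (\<lambda>x. \<Sum>i<n. c * indicator (A i) (cis x))" for n
        by (intro spanned_sum union.IH)
      have A_borel: "A i \<in> sets borel" for i
        using union.hyps by (auto simp: borel_eq_closed)
      show "(\<lambda>x. c * indicator (\<Union> (range A)) (cis x)) \<in> borel_measurable circle"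
      proof -
        have [measurable]: "\<Union> (range A) \<in> sets borel"
          by (rule sets.countable_UN) (use A_borel in auto)
        show ?thesis by measurable
      qed
      \<comment> \<open>Disjointness makes each partial sum a multiple of one indicator, which gives
        the uniform bound \<open>cmod c\<close>.\<close>
      have part: "(\<Sum>i<n. c * indicator (A i) z) = c * indicator (\<Union>i<n. A i) z" for n z
      proof -
        have "disjoint_family_on A {..<n}"
          using union.hyps by (auto simp: disjoint_family_on_def)
        then have "indicator (\<Union>i<n. A i) z = (\<Sum>i<n. indicator (A i) z :: complex)"
          by (rule indicator_UN_disjoint[OF finite_lessThan])
        then show ?thesis by (simp only: sum_distrib_left)
      qed
      show "cmod (\<Sum>i<n. c * indicator (A i) (cis x)) \<le> cmod c" for n x
        unfolding part by (simp add: indicator_def)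
      show "(\<lambda>n. \<Sum>i<n. c * indicator (A i) (cis x)) \<longlonglongrightarrow> c * indicator (\<Union> (range A)) (cis x)" for x
        unfolding part by (intro tendsto_mult_left LIMSEQ_indicator_UN)
    qed (rule integrable_circle_const)
  qed
qed

text \<open>\<open>Arg2pi\<close> is continuous off the nonnegative real axis and 0 on it, so it
  equals its own product with the indicator of the complement.\<close>

lemma borel_measurable_Arg2pi: "Arg2pi \<in> borel_measurable borel"
proof -
  have "(\<lambda>z. indicator (- \<real>\<^sub>\<ge>\<^sub>0) z *\<^sub>R Arg2pi z) \<in> borel_measurable borel"
    by (intro borel_measurable_continuous_on_indicator)
      (auto intro!: continuous_at_imp_continuous_on continuous_at_Arg2pi)
  also have "(\<lambda>z. indicator (- \<real>\<^sub>\<ge>\<^sub>0) z *\<^sub>R Arg2pi z) = Arg2pi"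
    by (auto simp: fun_eq_iff indicator_def Arg2pi_eq_0 complex_nonneg_Reals_iff complex_is_Real_iff)
  finally show ?thesis .
qed

text \<open>\<open>Arg2pi\<close> inverts \<open>cis\<close> on [0, 2 pi), so a set of parameters
  corresponds almost everywhere to the Borel set of the plane that is its preimage under
  \<open>Arg2pi\<close>.\<close>

lemma spanned_indicator:
  assumes "A \<in> sets circle"
  shows "spanned (\<lambda>x. c * indicator A x)"
proof (rule spanned_AE)
  have [measurable]: "A \<in> sets borel" using assms by (simp add: sets_circle)
  show "spanned (\<lambda>x. c * indicator (Arg2pi -` A) (cis x))"
    using measurable_sets[OF borel_measurable_Arg2pi, of A] by (intro spanned_indicator_borel) auto
  show "(\<lambda>x. c * indicator A x) \<in> borel_measurable circle" by measurable
  show "AE x in circle. c * indicator (Arg2pi -` A) (cis x) = c * indicator A x"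
    using AE_circle
  proof eventually_elim
    case (elim x)
    then have "Arg2pi (cis x) = x"
      by (intro Arg2pi_unique[of 1]) (auto simp: cis_conv_exp)
    then show ?case by (simp add: indicator_def)
  qed
qed

lemma spanned_square_integrable:
  assumes "square_integrable f"
  shows "spanned f"
proof -
  have f: "f \<in> borel_measurable circle" "integrable circle (\<lambda>x. (cmod (f x))\<^sup>2)"
    using assms by (auto simp: square_integrable_def)
  \<comment> \<open>With base point 0 the distance bound on the simple functions becomes the
    majorant \<open>2 * cmod (f x)\<close>.\<close>
  obtain u where u: "\<And>n. simple_function circle (u n)" "\<And>x. (\<lambda>n. u n x) \<longlonglongrightarrow> f x"
    "\<And>n x. cmod (u n x) \<le> 2 * cmod (f x)"
    using borel_measurable_implies_sequence_metric[OF f(1), of 0] by auto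
  show ?thesis
  proof (rule spanned_limit[OF _ f(1) _ u(3,2)])
    show "integrable circle (\<lambda>x. (2 * cmod (f x))\<^sup>2)"
      using f(2) by (simp add: power_mult_distrib)
    fix n
    have fin: "finite (range (u n))" and sets: "u n -` {y} \<in> sets circle" for y
      using simple_functionD(1)[OF u(1)[of n]] simple_functionD(2)[OF u(1)[of n], of "{y}"] by auto
    \<comment> \<open>A simple function is the finite sum of its values times the indicators of its
      level sets.\<close>
    have "spanned (\<lambda>x. \<Sum>y\<in>range (u n). y * indicator (u n -` {y}) x)"
      by (intro spanned_sum spanned_indicator sets)
    also have "(\<lambda>x. \<Sum>y\<in>range (u n). y * indicator (u n -` {y}) x) = u n"
    proof
      fix x
      have "(\<Sum>y\<in>range (u n). y * indicator (u n -` {y}) x) =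
          (\<Sum>y\<in>range (u n). if y = u n x then u n x else 0)"
        by (intro sum.cong) (auto simp: indicator_def)
      also have "\<dots> = u n x" using fin by simp
      finally show "(\<Sum>y\<in>range (u n). y * indicator (u n -` {y}) x) = u n x" .
    qed
    finally show "spanned (u n)" .
  qed
qed

lemma closure_span_characters: "closure (span characters) = UNIV"
proof -
  have "f \<in> closure (span characters)" for f
    by (induction f rule: L2T.abs_induct) (use spanned_square_integrable in \<open>auto simp: spanned_def\<close>)
  then show ?thesis by blast
qed

section \<open>Parseval's identity for Fourier coefficients and its consequences\<close>

lemma character_inner_character: "character c j \<bullet> character d k = (if j = k then Re (cnj d * c) else 0)"
  by (simp add: inner_character fourier_coeff_character)

text \<open>
  As a real inner product space, \<open>L\<^sup>2\<close> has the orthonormal system \<open>e\<^sub>k, \<i> e\<^sub>k\<close>, whose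
  coefficients are the real and imaginary parts of the Fourier coefficients.
\<close>

theorem parseval: "((\<lambda>k. (cmod (fourier_coeff f k))\<^sup>2) has_sum (norm f)\<^sup>2) UNIV"
proof -
  \<comment> \<open>Injectivity and disjointness allow the sum over the set
    \<open>characters\<close> to be split into its two families and each to be reindexed by the
    frequency.\<close>
  have inj: "inj (character c)" if "c \<noteq> 0" for c
    by (intro injI) (use that fourier_coeff_character in \<open>metis\<close>)
  have disj: "character 1 j \<noteq> character \<i> k" for j k
    using fourier_coeff_character[of 1 j j] fourier_coeff_character[of \<i> k j] by (auto split: if_splits)
  have "norm b = 1" if "b \<in> characters" for b
    using that by (auto simp: norm_eq_sqrt_inner character_inner_character)
  moreover have "pairwise orthogonal characters"
    by (auto simp: pairwise_def orthogonal_def character_inner_character)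
  ultimately have sum: "((\<lambda>b. (f \<bullet> b)\<^sup>2) has_sum (norm f)\<^sup>2) characters"
    using closure_span_characters by (intro parseval_orthonormal) auto
  have part: "(\<lambda>b. (f \<bullet> b)\<^sup>2) summable_on range (character c)" if "c = 1 \<or> c = \<i>" for c
    by (rule summable_on_subset_banach[OF has_sum_imp_summable[OF sum]]) (use that in auto)
  define s where "s c = (\<Sum>\<^sub>\<infinity>b\<in>range (character c). (f \<bullet> b)\<^sup>2)" for c
  have s: "((\<lambda>b. (f \<bullet> b)\<^sup>2) has_sum s c) (range (character c))" if "c = 1 \<or> c = \<i>" for c
    unfolding s_def using part[OF that] by (rule has_sum_infsum)
  have s': "((\<lambda>k. (f \<bullet> character c k)\<^sup>2) has_sum s c) UNIV" if "c = 1 \<or> c = \<i>" for c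
    using s[OF that] that inj[of c] by (subst (asm) has_sum_reindex) (auto simp: o_def)
  have "((\<lambda>b. (f \<bullet> b)\<^sup>2) has_sum (s 1 + s \<i>)) characters"
    by (intro has_sum_Un_disjoint s) (use disj in auto)
  then have "s 1 + s \<i> = (norm f)\<^sup>2" using sum has_sum_unique by blast
  then show ?thesis
    using has_sum_add[OF s'[of 1] s'[of \<i>]] by (simp add: inner_character cmod_power2)
qed

lemma has_sum_sum:
  fixes f :: "'i \<Rightarrow> 'k \<Rightarrow> 'a::topological_comm_monoid_add"
  assumes "\<And>i. i \<in> I \<Longrightarrow> (f i has_sum s i) A"
  shows "((\<lambda>k. \<Sum>i\<in>I. f i k) has_sum (\<Sum>i\<in>I. s i)) A"
  using assms by (induction I rule: infinite_finite_induct) (simp_all add: has_sum_add)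

text \<open>The direction of Parseval's identity used for upper bounds; through it Schur's test has
  to sum over finitely many rows only.\<close>

lemma norm_le_fourier_coeff:
  assumes "\<And>J. finite J \<Longrightarrow> (\<Sum>j\<in>J. (cmod (fourier_coeff f j))\<^sup>2) \<le> M\<^sup>2" "M \<ge> 0"
  shows "norm f \<le> M"
proof -
  have "(norm f)\<^sup>2 \<le> M\<^sup>2"
    by (rule has_sum_le_finite_sums[OF parseval]) (use assms in auto)
  then show ?thesis using assms(2) by (rule power2_le_imp_le)
qed

text \<open>The coefficients of the difference vanish, so the preceding bound applies with
  \<open>M\<close> = 0.\<close>

lemma fourier_coeff_inject:
  assumes "fourier_coeff f = fourier_coeff g"
  shows "f = g"
proof -
  have "fourier_coeff (f - g) k = 0" for k
    using fourier_coeff_add[of f "(-1) *\<^sub>R g" k] fourier_coeff_scaleR[of "-1" g k] assms by simp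
  then have "norm (f - g) \<le> 0"
    by (intro norm_le_fourier_coeff) auto
  then show ?thesis by simp
qed

text \<open>The matrix formula is linear in the coefficients of \<open>f\<close>; uniqueness of sums
  gives each identity coefficient by coefficient.\<close>

lemma linear_described_by_matrix:
  assumes "described_by_matrix W"
  shows "linear W"
proof (rule linearI)
  have W: "((\<lambda>k. matrix_of W j k * fourier_coeff f k) has_sum fourier_coeff (W f) j) UNIV" for f j
    using assms unfolding described_by_matrix_def by blast
  show "W (f + g) = W f + W g" for f g
  proof (rule fourier_coeff_inject, rule ext)
    fix j
    have "((\<lambda>k. matrix_of W j k * fourier_coeff (f + g) k) has_sum fourier_coeff (W f + W g) j) UNIV"
      using has_sum_add[OF W[of j f] W[of j g]] by (simp add: fourier_coeff_add distrib_left)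
    then show "fourier_coeff (W (f + g)) j = fourier_coeff (W f + W g) j"
      by (rule has_sum_unique[OF W])
  qed
  show "W (r *\<^sub>R f) = r *\<^sub>R W f" for r f
  proof (rule fourier_coeff_inject, rule ext)
    fix j
    have "((\<lambda>k. matrix_of W j k * fourier_coeff (r *\<^sub>R f) k) has_sum fourier_coeff (r *\<^sub>R W f) j) UNIV"
      using has_sum_cmult_right[OF W[of j f], of "of_real r"]
      by (simp add: fourier_coeff_scaleR mult.left_commute)
    then show "fourier_coeff (W (r *\<^sub>R f)) j = fourier_coeff (r *\<^sub>R W f) j"
      by (rule has_sum_unique[OF W])
  qed
qed

section \<open>Schur's test for operators of diagonal type\<close>

context
  fixes W :: "L2T \<Rightarrow> L2T"
  assumes W: "diagonal_type W"
begin

text \<open>The entry in row \<open>j\<close> and column \<open>k\<close> lies on diagonal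
  \<open>j - k\<close>; the \<open>bdd_above\<close> clause makes the supremum an actual upper
  bound.\<close>

lemma cmod_matrix_le_diagonal_sup: "cmod (matrix_of W j k) \<le> diagonal_sup W (j - k)"
  unfolding diagonal_sup_def
  using W cSUP_upper[of k UNIV "\<lambda>k'. cmod (matrix_of W ((j - k) + k') k')"]
  by (simp add: diagonal_type_def)

lemma diagonal_sup_nonneg: "0 \<le> diagonal_sup W k"
  using order_trans[OF norm_ge_zero cmod_matrix_le_diagonal_sup[of k 0]] by simp

lemma sum_diagonal_sup_le: "finite K \<Longrightarrow> (\<Sum>k\<in>K. diagonal_sup W k) \<le> DT_norm W"
  unfolding DT_norm_def
  using W by (intro finite_sum_le_infsum) (auto simp: diagonal_type_def diagonal_sup_nonneg)

lemma DT_norm_nonneg: "0 \<le> DT_norm W"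
  using sum_diagonal_sup_le[of "{}"] by simp

text \<open>Each weight is at most \<open>DT_norm W\<close>, so Parseval's series dominates.
  Summability matters because \<open>infsum\<close> defaults to 0 otherwise.\<close>

lemma summable_diagonal_sup_mult:
  "(\<lambda>k. diagonal_sup W (j - k) * (cmod (fourier_coeff f k))\<^sup>2) summable_on UNIV"
proof (rule summable_on_comparison_test)
  show "(\<lambda>k. DT_norm W * (cmod (fourier_coeff f k))\<^sup>2) summable_on UNIV"
    by (intro summable_on_cmult_right has_sum_imp_summable[OF parseval])
  show "diagonal_sup W (j - k) * (cmod (fourier_coeff f k))\<^sup>2 \<le>
      DT_norm W * (cmod (fourier_coeff f k))\<^sup>2" for k
    using sum_diagonal_sup_le[of "{j - k}"] by (intro mult_right_mono) auto
qed (simp add: diagonal_sup_nonneg)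

text \<open>Cauchy-Schwarz over finite sets of columns, with a bound independent of the set,
  followed by passage to the limit.\<close>

lemma cmod_fourier_coeff_le:
  "(cmod (fourier_coeff (W f) j))\<^sup>2 \<le>
    DT_norm W * (\<Sum>\<^sub>\<infinity>k. diagonal_sup W (j - k) * (cmod (fourier_coeff f k))\<^sup>2)"
    (is "_ \<le> ?R")
proof -
  let ?c = "\<lambda>k. diagonal_sup W (j - k)" and ?a = "\<lambda>k. cmod (fourier_coeff f k)"
  have "(cmod (\<Sum>k\<in>K. matrix_of W j k * fourier_coeff f k))\<^sup>2 \<le> ?R" if K: "finite K" for K
  proof -
    \<comment> \<open>Each weight is split into two square roots: one factor will contribute the row
      sum of the weights, the other the weighted squares.\<close>
    have "cmod (\<Sum>k\<in>K. matrix_of W j k * fourier_coeff f k) \<le> (\<Sum>k\<in>K. sqrt (?c k) * (sqrt (?c k) * ?a k))"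
      by (intro sum_norm_le)
        (simp add: norm_mult mult_right_mono cmod_matrix_le_diagonal_sup diagonal_sup_nonneg
          flip: mult.assoc)
    then have "(cmod (\<Sum>k\<in>K. matrix_of W j k * fourier_coeff f k))\<^sup>2 \<le>
        (\<Sum>k\<in>K. sqrt (?c k) * (sqrt (?c k) * ?a k))\<^sup>2"
      by (intro power_mono) auto
    also have "\<dots> \<le> (\<Sum>k\<in>K. (sqrt (?c k))\<^sup>2) * (\<Sum>k\<in>K. (sqrt (?c k) * ?a k)\<^sup>2)"
      by (rule Cauchy_Schwarz_ineq_sum)
    also have "\<dots> = (\<Sum>k\<in>K. ?c k) * (\<Sum>k\<in>K. ?c k * (?a k)\<^sup>2)"
      by (simp add: power_mult_distrib diagonal_sup_nonneg)
    also have "\<dots> \<le> ?R"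
    proof (intro mult_mono DT_norm_nonneg finite_sum_le_infsum summable_diagonal_sup_mult K)
      \<comment> \<open>Along a row, distinct columns meet distinct diagonals.\<close>
      have "(\<Sum>k\<in>K. ?c k) = (\<Sum>k\<in>(\<lambda>k. j - k) ` K. diagonal_sup W k)"
        by (subst sum.reindex) (auto simp: inj_on_def)
      also have "\<dots> \<le> DT_norm W" using K by (intro sum_diagonal_sup_le) auto
      finally show "(\<Sum>k\<in>K. ?c k) \<le> DT_norm W" .
    qed (auto simp: diagonal_sup_nonneg sum_nonneg)
    finally show ?thesis .
  qed
  moreover have "((\<lambda>K. (cmod (\<Sum>k\<in>K. matrix_of W j k * fourier_coeff f k))\<^sup>2) \<longlongrightarrow>
      (cmod (fourier_coeff (W f) j))\<^sup>2) (finite_subsets_at_top UNIV)"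
    using W by (intro tendsto_intros)
      (auto simp: diagonal_type_def described_by_matrix_def has_sum_def)
  ultimately show ?thesis
    by (intro tendsto_upperbound eventually_finite_subsets_at_top_weakI) auto
qed

text \<open>One factor \<open>DT_norm W\<close> comes from the row estimate; the other bounds the
  sum of the weights down a column after the sums are exchanged.\<close>

lemma norm_le_DT_norm: "norm (W f) \<le> DT_norm W * norm f"
proof (rule norm_le_fourier_coeff)
  fix J :: "int set" assume J: "finite J"
  let ?a = "\<lambda>k. (cmod (fourier_coeff f k))\<^sup>2"
  \<comment> \<open>As \<open>J\<close> is finite, exchanging the sums is mere additivity.\<close>
  have sum_sums: "((\<lambda>k. \<Sum>j\<in>J. diagonal_sup W (j - k) * ?a k) has_sum
      (\<Sum>j\<in>J. \<Sum>\<^sub>\<infinity>k. diagonal_sup W (j - k) * ?a k)) UNIV"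
    by (intro has_sum_sum has_sum_infsum summable_diagonal_sup_mult)
  have "(\<Sum>j\<in>J. (cmod (fourier_coeff (W f) j))\<^sup>2) \<le>
      (\<Sum>j\<in>J. DT_norm W * (\<Sum>\<^sub>\<infinity>k. diagonal_sup W (j - k) * ?a k))"
    by (intro sum_mono cmod_fourier_coeff_le)
  also have "\<dots> = DT_norm W * (\<Sum>\<^sub>\<infinity>k. \<Sum>j\<in>J. diagonal_sup W (j - k) * ?a k)"
    by (simp add: sum_distrib_left[symmetric] infsumI[OF sum_sums])
  also have "\<dots> \<le> DT_norm W * (\<Sum>\<^sub>\<infinity>k. DT_norm W * ?a k)"
  proof (intro mult_left_mono infsum_mono DT_norm_nonneg)
    show "(\<lambda>k. \<Sum>j\<in>J. diagonal_sup W (j - k) * ?a k) summable_on UNIV"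
      by (rule has_sum_imp_summable[OF sum_sums])
    show "(\<lambda>k. DT_norm W * ?a k) summable_on UNIV"
      by (intro summable_on_cmult_right has_sum_imp_summable[OF parseval])
    fix k
    \<comment> \<open>Down a column, distinct rows meet distinct diagonals.\<close>
    have "(\<Sum>j\<in>J. diagonal_sup W (j - k)) = (\<Sum>i\<in>(\<lambda>j. j - k) ` J. diagonal_sup W i)"
      by (subst sum.reindex) (auto simp: inj_on_def)
    also have "\<dots> \<le> DT_norm W" using J by (intro sum_diagonal_sup_le) auto
    finally show "(\<Sum>j\<in>J. diagonal_sup W (j - k) * ?a k) \<le> DT_norm W * ?a k"
      by (simp add: sum_distrib_right[symmetric] mult_right_mono)
  qed
  also have "\<dots> = (DT_norm W * norm f)\<^sup>2"
    using infsumI[OF has_sum_cmult_right[OF parseval[of f], of "DT_norm W"]]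
    by (simp add: power2_eq_square)
  finally show "(\<Sum>j\<in>J. (cmod (fourier_coeff (W f) j))\<^sup>2) \<le> (DT_norm W * norm f)\<^sup>2" .
qed (simp add: DT_norm_nonneg)

end

text \<open>\<open>onorm\<close> is a real supremum, meaningful as an operator norm only for bounded
  operators, so boundedness is asserted along with the estimate.\<close>

theorem lemma7p3:
  fixes W :: "L2T \<Rightarrow> L2T"
  assumes "diagonal_type W"
  shows "bounded_linear W \<and> onorm W \<le> DT_norm W"
proof
  interpret W: linear W
    using assms unfolding diagonal_type_def by (blast intro: linear_described_by_matrix)
  show "bounded_linear W"
  proof (rule bounded_linear_intro[where K = "DT_norm W"])
    show "norm (W f) \<le> norm f * DT_norm W" for f
      using norm_le_DT_norm[OF assms, of f] by (simp only: mult.commute)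
  qed (rule W.add W.scale)+
  show "onorm W \<le> DT_norm W"
    using DT_norm_nonneg[OF assms] norm_le_DT_norm[OF assms] by (rule onorm_bound)
qed

end
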